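(* Let $n\ge1$, let $\mathcal{H}^n$ be hyperbolic $n$-space with its hyperbolic metric $d$, let $A\subset\mathcal{H}^n$ be a set of points (not necessarily finite), and let $\sigma=[a_0a_1\ldots a_p]$, $p\ge0$, be a simplex with vertices in $A$. Then: (1) $\sigma$ has a strong witness in $\mathcal{H}^n$ with respect to $A$ if and only if every subsimplex $\tau\le\sigma$ has a weak witness in $\mathcal{H}^n$ with respect to $A$. (2) If for every nonempty $I\subseteq\{a_0,\ldots,a_p\}$ a weak witness $x_I\in\mathcal{H}^n$ with respect to $A$ is given for the subsimplex $\sigma_I$ with vertex set $I$, then the geodesic convex hull of the points $x_I$ contains a strong witness for $\sigma$ with respect to $A$.
   Context: A simplex $\sigma=[a_0\ldots a_p]$ with vertices in $A$ is a set of $p+1$ distinct points $\{a_0,\ldots,a_p\}\subseteq A$; a subsimplex $\tau\le\sigma$ is a simplex whose vertex set is a nonempty subset of that of $\sigma$ (including $\sigma$ itself). A point $x\in\mathcal{H}^n$ is a weak witness for $\sigma$ with respect to $A$ if $d(x,a)\le d(x,b)$ whenever $a\in\{a_0,\ldots,a_p\}$ and $b\in A\setminus\{a_0,\ldots,a_p\}$. It is a strong witness for $\sigma$ with respect to $A$ if it is a weak witness and additionally $d(x,a_0)=d(x,a_1)=\cdots=d(x,a_p)$. A subset of $\mathcal{H}^n$ is geodesically convex if it contains the unique geodesic arc between any two of its points; the geodesic convex hull of a set is the smallest geodesically convex subset containing it. *)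

theory Defs
  imports "HOL-Analysis.Analysis"
begin

text \<open>
  Hyperbolic space of dimension \<open>CARD('n)\<close> in the hyperboloid model: the upper sheet of the
  two-sheeted hyperboloid in Lorentzian space, whose points are written as pairs of a space and a
  time component. The Lorentzian form has signature \<open>(n, 1)\<close>.
\<close>

definition lorentz_form :: "(real ^ 'n) \<times> real \<Rightarrow> (real ^ 'n) \<times> real \<Rightarrow> real" where
  "lorentz_form x y = fst x \<bullet> fst y - snd x * snd y"

definition hyperbolic_space :: "((real ^ 'n) \<times> real) set" where
  "hyperbolic_space = {x. lorentz_form x x = -1 \<and> snd x > 0}"

text \<open>Only meaningful for points of \<open>hyperbolic_space\<close>, where the argument of \<open>arcosh\<close> is at
  least 1.\<close>

definition hyp_dist :: "(real ^ 'n) \<times> real \<Rightarrow> (real ^ 'n) \<times> real \<Rightarrow> real" where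
  "hyp_dist x y = arcosh (- lorentz_form x y)"

definition geodesic_arc ::
  "(real ^ 'n) \<times> real \<Rightarrow> (real ^ 'n) \<times> real \<Rightarrow> ((real ^ 'n) \<times> real) set \<Rightarrow> bool" where
  "geodesic_arc x y G \<longleftrightarrow>
     (\<exists>\<gamma>. \<gamma> ` {0..hyp_dist x y} \<subseteq> hyperbolic_space \<and>
          \<gamma> 0 = x \<and> \<gamma> (hyp_dist x y) = y \<and>
          (\<forall>s\<in>{0..hyp_dist x y}. \<forall>t\<in>{0..hyp_dist x y}. hyp_dist (\<gamma> s) (\<gamma> t) = \<bar>s - t\<bar>) \<and>
          G = \<gamma> ` {0..hyp_dist x y})"

text \<open>Any two points of hyperbolic space are joined by exactly one geodesic arc, so quantifying
  over all arcs below amounts to speaking of the arc between the two points.\<close>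

definition geodesically_convex :: "((real ^ 'n) \<times> real) set \<Rightarrow> bool" where
  "geodesically_convex C \<longleftrightarrow>
     C \<subseteq> hyperbolic_space \<and> (\<forall>x\<in>C. \<forall>y\<in>C. \<forall>G. geodesic_arc x y G \<longrightarrow> G \<subseteq> C)"

text \<open>A simplex is identified with its vertex set.\<close>

definition simplex_in :: "'a set \<Rightarrow> nat \<Rightarrow> 'a set \<Rightarrow> bool" where
  "simplex_in A p \<sigma> \<longleftrightarrow> \<sigma> \<subseteq> A \<and> finite \<sigma> \<and> card \<sigma> = p + 1"

definition subsimplex :: "'a set \<Rightarrow> 'a set \<Rightarrow> bool" where
  "subsimplex \<tau> \<sigma> \<longleftrightarrow> \<tau> \<noteq> {} \<and> \<tau> \<subseteq> \<sigma>"

definition weak_witness ::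
  "((real ^ 'n) \<times> real) set \<Rightarrow> ((real ^ 'n) \<times> real) set \<Rightarrow> (real ^ 'n) \<times> real \<Rightarrow> bool" where
  "weak_witness A \<sigma> x \<longleftrightarrow>
     x \<in> hyperbolic_space \<and> (\<forall>a\<in>\<sigma>. \<forall>b\<in>A - \<sigma>. hyp_dist x a \<le> hyp_dist x b)"

definition strong_witness ::
  "((real ^ 'n) \<times> real) set \<Rightarrow> ((real ^ 'n) \<times> real) set \<Rightarrow> (real ^ 'n) \<times> real \<Rightarrow> bool" where
  "strong_witness A \<sigma> x \<longleftrightarrow>
     weak_witness A \<sigma> x \<and> (\<forall>a\<in>\<sigma>. \<forall>b\<in>\<sigma>. hyp_dist x a = hyp_dist x b)"

end

theory Submission
  imports Defs
begin

text \<open>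
  Since \<open>hyp_dist x a\<close> increases with the linear functional \<open>- lorentz_form x a\<close> of \<open>x\<close>, being a
  witness is a system of homogeneous linear inequalities. If no convex combination of the weak
  witnesses \<open>x I\<close> satisfied the system for a strong witness, the Farkas lemma would yield a
  combination \<open>\<Sum>c. \<nu> c * - lorentz_form _ c\<close> with \<open>\<Sum>c. \<nu> c = 0\<close> and \<open>\<nu> \<ge> 0\<close> off \<open>\<sigma>\<close> that is negative at every
  \<open>x I\<close>; but at \<open>I = {c. \<nu> c < 0}\<close> it is nonnegative, because \<open>x I\<close> is at least as close to each
  point of \<open>I\<close> as to any other point of \<open>A\<close>. Finally, the cone over a geodesically convex set is
  convex, so rescaling the resulting convex combination to the hyperboloid stays in the hull.
\<close>

section \<open>Convex combinations and linear duality\<close>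

lemma exists_convex_comb_minimizing_all:
  fixes g :: "'b \<Rightarrow> 'a::euclidean_space" and x :: "'b set \<Rightarrow> 'a"
  assumes \<sigma>: "finite \<sigma>" "\<sigma> \<noteq> {}" "\<sigma> \<subseteq> A"
    and weak: "\<And>I a b. \<lbrakk>I \<noteq> {}; I \<subseteq> \<sigma>; a \<in> I; b \<in> A - I\<rbrakk> \<Longrightarrow> x I \<bullet> g a \<le> x I \<bullet> g b"
  shows "\<exists>z \<in> convex hull {x I | I. I \<noteq> {} \<and> I \<subseteq> \<sigma>}. \<forall>a\<in>\<sigma>. \<forall>b\<in>A. z \<bullet> g a \<le> z \<bullet> g b"
proof (rule ccontr)
  assume neg: "\<not> ?thesis"
  define X where "X = {x I | I. I \<noteq> {} \<and> I \<subseteq> \<sigma>}"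
  define D where "D = {z. \<forall>a\<in>\<sigma>. \<forall>b\<in>A. z \<bullet> g a \<le> z \<bullet> g b}"
  \<comment> \<open>\<open>closure P\<close> is the dual cone of \<open>D\<close>. As \<open>X\<close> is finite, an element of \<open>closure P\<close> that is negative
    on \<open>X\<close> can be moved into \<open>P\<close> itself.\<close>
  define P where "P = {q. \<exists>F \<nu>. finite F \<and> F \<subseteq> A \<and> (\<forall>c. c \<notin> F \<longrightarrow> \<nu> c = 0) \<and> sum \<nu> F = 0
    \<and> (\<forall>c. c \<notin> \<sigma> \<longrightarrow> \<nu> c \<ge> 0) \<and> q = (\<Sum>c\<in>F. \<nu> c *\<^sub>R g c)}"
  have "X = x ` {I \<in> Pow \<sigma>. I \<noteq> {}}" by (auto simp: X_def)
  then have finX: "finite X" using \<sigma>(1) by simp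
  have neX: "X \<noteq> {}" using \<sigma>(2) by (auto simp: X_def)
  have D_cone: "t *\<^sub>R z \<in> D" if "z \<in> D" "t \<ge> 0" for t z
    using that by (auto simp: D_def intro: mult_left_mono)
  have D_add: "y + z \<in> D" if "y \<in> D" "z \<in> D" for y z
    using that by (auto simp: D_def inner_add_left intro: add_mono)
  have D_convex: "convex D"
    unfolding convex_def using D_cone D_add by blast
  have "D = (\<Inter>a\<in>\<sigma>. \<Inter>b\<in>A. {z. z \<bullet> g a \<le> z \<bullet> g b})" by (auto simp: D_def)
  then have D_closed: "closed D"
    by (auto intro!: closed_INT closed_Collect_le continuous_intros)
  have "convex hull X \<inter> D = {}"
    using neg by (auto simp: X_def D_def)
  \<comment> \<open>The hull is compact because \<open>X\<close> is finite, and \<open>D\<close> is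
    closed. Since \<open>0 \<in> D\<close>, the separating value \<open>\<beta>\<close> is
    negative.\<close>
  then obtain w \<beta> where w: "\<And>z. z \<in> convex hull X \<Longrightarrow> w \<bullet> z < \<beta>" "\<And>z. z \<in> D \<Longrightarrow> w \<bullet> z > \<beta>"
    using separating_hyperplane_compact_closed[of "convex hull X" D] finX neX D_convex D_closed
    by (metis convex_convex_hull convex_hull_eq_empty finite_imp_compact_convex_hull)
  have "0 \<in> D" by (simp add: D_def)
  then have "\<beta> < 0" using w(2)[of 0] by simp
  have w_nonneg: "w \<bullet> z \<ge> 0" if "z \<in> D" for z
  proof (rule ccontr)
    assume "\<not> w \<bullet> z \<ge> 0"
    then have "w \<bullet> z < 0" by simp
    then show False
      \<comment> \<open>The positive factor \<open>\<beta> / (w \<bullet> z)\<close> rescales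
        \<open>z\<close> within the cone \<open>D\<close> to a point where \<open>w\<close> takes
        the value \<open>\<beta>\<close>, which the separation excludes.\<close>
      using w(2)[OF D_cone[OF that, of "\<beta> / (w \<bullet> z)"]] \<open>\<beta> < 0\<close> by (simp add: divide_nonpos_neg)
  qed
  have P_cone: "t *\<^sub>R q \<in> P" if "q \<in> P" "t \<ge> 0" for t q
  proof -
    from that(1) obtain F \<nu> where "finite F" "F \<subseteq> A" "\<forall>c. c \<notin> F \<longrightarrow> \<nu> c = 0" "sum \<nu> F = 0"
      "\<forall>c. c \<notin> \<sigma> \<longrightarrow> \<nu> c \<ge> 0" "q = (\<Sum>c\<in>F. \<nu> c *\<^sub>R g c)" by (auto simp: P_def)
    then show ?thesis unfolding P_def using that(2)
      by (intro CollectI exI[of _ F] exI[of _ "\<lambda>c. t * \<nu> c"])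
        (auto simp: scaleR_sum_right simp flip: sum_distrib_left)
  qed
  have P_add: "q + r \<in> P" if qr: "q \<in> P" "r \<in> P" for q r
  proof -
    from qr(1) obtain F \<nu> where F: "finite F" "F \<subseteq> A" "\<forall>c. c \<notin> F \<longrightarrow> \<nu> c = 0" "sum \<nu> F = 0"
      "\<forall>c. c \<notin> \<sigma> \<longrightarrow> \<nu> c \<ge> 0" "q = (\<Sum>c\<in>F. \<nu> c *\<^sub>R g c)" by (auto simp: P_def)
    from qr(2) obtain G \<mu> where G: "finite G" "G \<subseteq> A" "\<forall>c. c \<notin> G \<longrightarrow> \<mu> c = 0" "sum \<mu> G = 0"
      "\<forall>c. c \<notin> \<sigma> \<longrightarrow> \<mu> c \<ge> 0" "r = (\<Sum>c\<in>G. \<mu> c *\<^sub>R g c)" by (auto simp: P_def)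
    \<comment> \<open>Coefficients vanish outside their supports, so all sums can be taken over
      \<open>F \<union> G\<close>.\<close>
    have "sum \<nu> (F \<union> G) = sum \<nu> F" "sum \<mu> (F \<union> G) = sum \<mu> G"
      "(\<Sum>c\<in>F \<union> G. \<nu> c *\<^sub>R g c) = q" "(\<Sum>c\<in>F \<union> G. \<mu> c *\<^sub>R g c) = r"
      unfolding F(6) G(6) using F(1,3) G(1,3) by (auto intro!: sum.mono_neutral_right)
    then show ?thesis unfolding P_def using F(1-5) G(1-5)
      by (intro CollectI exI[of _ "F \<union> G"] exI[of _ "\<lambda>c. \<nu> c + \<mu> c"])
        (auto simp: sum.distrib scaleR_add_left)
  qed
  \<comment> \<open>These are the functionals that define \<open>D\<close>. For \<open>a = b\<close>
    the two-point coefficients would sum to -1, hence the empty support.\<close>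
  have P_diff: "g b - g a \<in> P" if "a \<in> \<sigma>" "b \<in> A" for a b
  proof (cases "a = b")
    case True
    then show ?thesis unfolding P_def by (intro CollectI exI[of _ "{}"] exI[of _ "\<lambda>_. 0"]) auto
  next
    case False
    then show ?thesis unfolding P_def using that \<sigma>(3)
      by (intro CollectI exI[of _ "{a, b}"] exI[of _ "\<lambda>c. if c = a then -1 else if c = b then 1 else 0"]) auto
  qed
  obtain a0 where "a0 \<in> \<sigma>" using \<sigma>(2) by blast
  then have P_zero: "0 \<in> P" using P_diff[of a0 a0] \<sigma>(3) by auto
  have P_convex: "convex P" unfolding convex_def using P_cone P_add by blast
  \<comment> \<open>Bipolar argument: a vector \<open>u\<close> separating \<open>w\<close> from
    \<open>P\<close> is nonnegative on all \<open>g b - g a\<close>, so it lies in \<open>D\<close>,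
    where \<open>w\<close> is nonnegative.\<close>
  have "w \<in> closure P"
  proof (rule ccontr)
    assume "w \<notin> closure P"
    then obtain u \<gamma> where u: "u \<bullet> w < \<gamma>" "\<And>q. q \<in> closure P \<Longrightarrow> u \<bullet> q > \<gamma>"
      using separating_hyperplane_closed_point[of "closure P" w] P_convex
      by (auto simp: convex_closure)
    have uP: "u \<bullet> q > \<gamma>" if "q \<in> P" for q using u(2) closure_subset that by blast
    have "\<gamma> < 0" using uP[OF P_zero] by simp
    have "u \<in> D"
      unfolding D_def
    proof (intro CollectI ballI, rule ccontr)
      fix a b assume ab: "a \<in> \<sigma>" "b \<in> A" and "\<not> u \<bullet> g a \<le> u \<bullet> g b"
      then have *: "u \<bullet> (g b - g a) < 0" by (simp add: inner_diff_right)
      with uP[OF P_cone[OF P_diff[OF ab], of "\<gamma> / (u \<bullet> (g b - g a))"]] \<open>\<gamma> < 0\<close>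
      show False by (simp add: divide_nonpos_neg)
    qed
    then show False using w_nonneg[of u] u(1) \<open>\<gamma> < 0\<close> by (simp add: inner_commute)
  qed
  moreover have "open (\<Inter>y\<in>X. {q. q \<bullet> y < 0})"
    using finX by (auto intro!: open_INT open_Collect_less continuous_intros)
  moreover have "w \<in> (\<Inter>y\<in>X. {q. q \<bullet> y < 0})"
    using w(1) \<open>\<beta> < 0\<close> by (auto intro: less_trans hull_inc)
  ultimately have "(\<Inter>y\<in>X. {q. q \<bullet> y < 0}) \<inter> P \<noteq> {}"
    using open_Int_closure_eq_empty by blast
  then obtain q where q: "q \<in> P" "\<And>y. y \<in> X \<Longrightarrow> q \<bullet> y < 0" by blast
  from q(1) obtain F \<nu> where F: "finite F" "F \<subseteq> A" "\<forall>c. c \<notin> F \<longrightarrow> \<nu> c = 0" "sum \<nu> F = 0"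
      "\<forall>c. c \<notin> \<sigma> \<longrightarrow> \<nu> c \<ge> 0" "q = (\<Sum>c\<in>F. \<nu> c *\<^sub>R g c)" by (auto simp: P_def)
  define I where "I = {c \<in> \<sigma>. \<nu> c < 0}"
  show False
  proof (cases "I = {}")
    case True
    then have "\<forall>c\<in>F. \<nu> c \<ge> 0" using F(5) by (force simp: I_def)
    then have "\<forall>c\<in>F. \<nu> c = 0" using F(1,4) by (simp add: sum_nonneg_eq_0_iff)
    then have "q = 0" using F(6) by simp
    then show False using q(2) neX by auto
  next
    case False
    have "I \<subseteq> \<sigma>" by (auto simp: I_def)
    then have finI: "finite I" using \<sigma>(1) finite_subset by blast
    \<comment> \<open>\<open>M\<close> separates the values on \<open>I\<close> from those on
      \<open>A - I\<close>. As the coefficients sum to 0, subtracting \<open>M\<close> from every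
      value leaves the total unchanged and makes each term nonnegative.\<close>
    define M where "M = Max ((\<lambda>a. x I \<bullet> g a) ` I)"
    have le_M: "x I \<bullet> g a \<le> M" if "a \<in> I" for a
      using that finI by (simp add: M_def)
    have "M \<in> (\<lambda>a. x I \<bullet> g a) ` I"
      unfolding M_def using finI False by (intro Max_in) auto
    then obtain m where m: "m \<in> I" "M = x I \<bullet> g m" by blast
    have ge_M: "M \<le> x I \<bullet> g b" if "b \<in> A - I" for b
      using weak[OF False \<open>I \<subseteq> \<sigma>\<close> m(1) that] m(2) by simp
    have "0 = (\<Sum>c\<in>F. \<nu> c * M)" using F(4) by (simp flip: sum_distrib_right)
    also have "\<dots> \<le> (\<Sum>c\<in>F. \<nu> c * (x I \<bullet> g c))"
    proof (rule sum_mono)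
      fix c assume "c \<in> F"
      show "\<nu> c * M \<le> \<nu> c * (x I \<bullet> g c)"
      proof (cases "c \<in> I")
        case True
        then show ?thesis using le_M by (auto simp: I_def intro: mult_left_mono_neg)
      next
        case False
        then have "\<nu> c \<ge> 0" using F(5) by (force simp: I_def)
        then show ?thesis using ge_M[of c] False F(2) \<open>c \<in> F\<close> by (auto intro: mult_left_mono)
      qed
    qed
    also have "\<dots> = q \<bullet> x I" by (simp add: F(6) inner_sum_left inner_commute[of "x I"])
    finally show False using q(2)[of "x I"] False \<open>I \<subseteq> \<sigma>\<close> by (auto simp: X_def)
  qed
qed

section \<open>The Lorentzian form on the hyperboloid\<close>

lemma lorentz_form_commute: "lorentz_form x y = lorentz_form y x"
  by (simp add: lorentz_form_def inner_commute mult.commute)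

lemma lorentz_form_linear [simp]:
  "lorentz_form (x + y) z = lorentz_form x z + lorentz_form y z"
  "lorentz_form z (x + y) = lorentz_form z x + lorentz_form z y"
  "lorentz_form (t *\<^sub>R x) z = t * lorentz_form x z"
  "lorentz_form z (t *\<^sub>R x) = t * lorentz_form z x"
  by (simp_all add: lorentz_form_def algebra_simps)

lemma hyperbolic_space_snd:
  assumes "x \<in> hyperbolic_space"
  shows "(snd x)\<^sup>2 = 1 + (norm (fst x))\<^sup>2" "snd x > 0"
  using assms unfolding hyperbolic_space_def lorentz_form_def power2_norm_eq_inner
  by (simp_all add: power2_eq_square)

text \<open>For norms u, v and time components s, t, the hyperboloid equations give (s t)^2 = (1 + u
  v)^2 + (u - v)^2.\<close>

lemma one_plus_norms_le:
  assumes "x \<in> hyperbolic_space" "y \<in> hyperbolic_space"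
  shows "1 + norm (fst x) * norm (fst y) \<le> snd x * snd y"
    and "snd x * snd y = 1 + norm (fst x) * norm (fst y) \<Longrightarrow> norm (fst x) = norm (fst y)"
proof -
  let ?u = "norm (fst x)" and ?v = "norm (fst y)"
  have 1: "(snd x)\<^sup>2 = 1 + ?u\<^sup>2" "(snd y)\<^sup>2 = 1 + ?v\<^sup>2" "snd x > 0" "snd y > 0"
    using assms by (simp_all add: hyperbolic_space_snd)
  have 2: "(snd x * snd y)\<^sup>2 = (1 + ?u * ?v)\<^sup>2 + (?u - ?v)\<^sup>2"
    unfolding power_mult_distrib 1 by (simp add: power2_eq_square algebra_simps)
  have "(1 + ?u * ?v)\<^sup>2 \<le> (snd x * snd y)\<^sup>2" unfolding 2 by simp
  then show "1 + ?u * ?v \<le> snd x * snd y"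
    by (rule power2_le_imp_le) (simp add: 1 less_imp_le)
  show "?u = ?v" if "snd x * snd y = 1 + ?u * ?v"
    using 2 unfolding that by simp
qed

text \<open>Reversed Cauchy-Schwarz inequality; it puts the argument of \<open>arcosh\<close> in
  \<open>hyp_dist\<close> where \<open>arcosh\<close> is increasing.\<close>

lemma lorentz_form_le:
  assumes "x \<in> hyperbolic_space" "y \<in> hyperbolic_space"
  shows "lorentz_form x y \<le> -1"
  using one_plus_norms_le(1)[OF assms] norm_cauchy_schwarz[of "fst x" "fst y"]
  by (simp add: lorentz_form_def)

text \<open>Equality forces equal norms, hence equal time components, and then the space components
  differ by a vector of norm 0. This makes the distance of distinct points positive.\<close>

lemma lorentz_form_eq_minus_one:
  assumes xy: "x \<in> hyperbolic_space" "y \<in> hyperbolic_space" and "lorentz_form x y = -1"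
  shows "x = y"
proof -
  have eq: "fst x \<bullet> fst y = snd x * snd y - 1" using assms(3) by (simp add: lorentz_form_def)
  have uv: "norm (fst x) = norm (fst y)"
    using one_plus_norms_le[OF xy] norm_cauchy_schwarz[of "fst x" "fst y"] eq by auto
  have *: "(snd x)\<^sup>2 = 1 + (norm (fst x))\<^sup>2" "(snd y)\<^sup>2 = 1 + (norm (fst y))\<^sup>2" "snd x > 0" "snd y > 0"
    using xy by (simp_all add: hyperbolic_space_snd)
  then have "snd x = snd y" using uv by (metis less_eq_real_def power2_eq_imp_eq)
  moreover have "(norm (fst x - fst y))\<^sup>2 = 0"
    using eq * uv calculation unfolding power2_norm_eq_inner
    by (simp add: inner_diff inner_commute power2_eq_square)
  ultimately show ?thesis by (simp add: prod_eq_iff)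
qed

lemma hyp_dist_le_iff:
  assumes "x \<in> hyperbolic_space" "a \<in> hyperbolic_space" "b \<in> hyperbolic_space"
  shows "hyp_dist x a \<le> hyp_dist x b \<longleftrightarrow> lorentz_form x b \<le> lorentz_form x a"
  using lorentz_form_le[OF assms(1,2)] lorentz_form_le[OF assms(1,3)]
  by (simp add: hyp_dist_def flip: not_less)

section \<open>Geodesics as central projections of segments\<close>

text \<open>The ray through a positive combination of \<open>x\<close> and \<open>y\<close> crosses
  the hyperboloid on their geodesic. One arc suffices, since \<open>geodesically_convex\<close>
  speaks of all arcs.\<close>

lemma geodesic_arc_meets_cone:
  fixes x y :: "(real ^ 'n) \<times> real"
  assumes xy: "x \<in> hyperbolic_space" "y \<in> hyperbolic_space" and pos: "\<alpha> > 0" "\<beta> > 0"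
  obtains G z k where "geodesic_arc x y G" "z \<in> G" "k > 0" "\<alpha> *\<^sub>R x + \<beta> *\<^sub>R y = k *\<^sub>R z"
proof (cases "x = y")
  case True
  have "hyp_dist x x = 0" using xy(1) by (simp add: hyp_dist_def hyperbolic_space_def)
  then have "geodesic_arc x y {x}"
    unfolding geodesic_arc_def using True xy by (intro exI[of _ "\<lambda>_. x"]) auto
  then show ?thesis using that[of "{x}" x "\<alpha> + \<beta>"] True pos by (simp add: scaleR_add_left)
next
  case False
  define d where "d = hyp_dist x y"
  have "- lorentz_form x y > 1"
    using lorentz_form_le[OF xy] lorentz_form_eq_minus_one[OF xy] False by fastforce
  then have d_pos: "d > 0" and cosh_d: "lorentz_form x y = - cosh d"
    by (auto simp: d_def hyp_dist_def)
  define S where "S = sinh d"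
  have S: "S > 0" using d_pos by (simp add: S_def)
  \<comment> \<open>Hyperbolic analogue of spherical linear interpolation, parametrized by arc
    length.\<close>
  define \<gamma> where "\<gamma> s = (sinh (d - s) / S) *\<^sub>R x + (sinh s / S) *\<^sub>R y" for s
  have xx: "lorentz_form x x = -1" "lorentz_form y y = -1" "lorentz_form y x = - cosh d"
    using xy cosh_d by (auto simp: hyperbolic_space_def lorentz_form_commute[of y x])
  have form: "lorentz_form (\<gamma> s) (\<gamma> t) = - cosh (s - t)" for s t
  proof -
    have "S\<^sup>2 * lorentz_form (\<gamma> s) (\<gamma> t) = - (sinh (d - s) * sinh (d - t) + sinh s * sinh t
        + cosh d * (sinh (d - s) * sinh t + sinh s * sinh (d - t)))"
      using S by (simp add: \<gamma>_def xx cosh_d field_simps power2_eq_square)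
    \<comment> \<open>Expanding \<open>sinh (d - s)\<close> and \<open>sinh (d - t)\<close> cancels
      the mixed terms.\<close>
    also have "\<dots> = - (S\<^sup>2 * (cosh s * cosh t) + (1 - (cosh d)\<^sup>2) * (sinh s * sinh t))"
      by (simp add: sinh_diff S_def power2_eq_square algebra_simps)
    also have "\<dots> = S\<^sup>2 * (- cosh (s - t))"
      by (simp add: cosh_diff S_def cosh_square_eq algebra_simps)
    finally show ?thesis using S by (metis mult_cancel_left less_irrefl zero_less_power)
  qed
  have snd_pos: "snd x > 0" "snd y > 0" using xy by (auto simp: hyperbolic_space_def)
  have \<gamma>_mem: "\<gamma> s \<in> hyperbolic_space" if "s \<in> {0..d}" for s
  proof -
    have "snd (\<gamma> s) > 0"
    proof (cases "s = 0")
      case True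
      then show ?thesis using snd_pos S by (simp add: \<gamma>_def S_def)
    next
      case False
      then have "sinh s > 0" "sinh (d - s) \<ge> 0" using that by auto
      then show ?thesis using snd_pos S by (auto simp: \<gamma>_def intro!: add_nonneg_pos)
    qed
    then show ?thesis by (simp add: hyperbolic_space_def form)
  qed
  have "hyp_dist (\<gamma> s) (\<gamma> t) = \<bar>s - t\<bar>" for s t
    using arcosh_cosh_real[of "\<bar>s - t\<bar>"] by (simp add: hyp_dist_def form)
  moreover have "\<gamma> 0 = x" "\<gamma> d = y" using S by (simp_all add: \<gamma>_def S_def)
  ultimately have arc: "geodesic_arc x y (\<gamma> ` {0..d})"
    unfolding geodesic_arc_def d_def[symmetric] using \<gamma>_mem by (intro exI[of _ \<gamma>]) auto
  \<comment> \<open>At a zero of \<open>h\<close> the two coefficients of \<open>\<gamma> s\<close>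
    are in the ratio \<open>\<alpha>\<close> to \<open>\<beta>\<close>; the intermediate value
    theorem supplies one.\<close>
  define h where "h s = \<alpha> * sinh s - \<beta> * sinh (d - s)" for s
  have "h 0 \<le> 0" "0 \<le> h d" using pos d_pos by (auto simp: h_def)
  moreover have "continuous_on {0..d} h" unfolding h_def by (intro continuous_intros)
  ultimately obtain s where s: "0 \<le> s" "s \<le> d" "h s = 0"
    using IVT'[of h 0 0 d] d_pos by auto
  have "s \<noteq> d" using s(3) pos d_pos by (auto simp: h_def)
  then have sh: "sinh (d - s) > 0" using s by simp
  define k where "k = \<alpha> * S / sinh (d - s)"
  have "k > 0" using sh S pos by (simp add: k_def)
  moreover have "k * (sinh (d - s) / S) = \<alpha>" using sh S by (simp add: k_def)
  moreover have "k * (sinh s / S) = \<beta>"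
    using sh S s(3) by (simp add: k_def h_def field_simps)
  ultimately show ?thesis
    using that[OF arc, of "\<gamma> s" k] s by (simp add: \<gamma>_def scaleR_add_right)
qed

text \<open>A positive combination of multiples of two points of \<open>C\<close> is a positive
  multiple of a point on an arc between them.\<close>

lemma convex_cone_over_geodesically_convex:
  assumes "geodesically_convex C"
  shows "convex {k *\<^sub>R c | k c. k > 0 \<and> c \<in> C}" (is "convex ?K")
proof -
  have "u *\<^sub>R a + v *\<^sub>R b \<in> ?K" if "a \<in> ?K" "b \<in> ?K" "u > 0" "v > 0" for a b u v
  proof -
    from that(1,2) obtain j k c e where
      *: "a = j *\<^sub>R c" "b = k *\<^sub>R e" "j > 0" "k > 0" "c \<in> C" "e \<in> C" by blast
    with assms have "c \<in> hyperbolic_space" "e \<in> hyperbolic_space"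
      by (auto simp: geodesically_convex_def)
    moreover have "u * j > 0" "v * k > 0" using * that by auto
    ultimately obtain G z l where "geodesic_arc c e G" "z \<in> G" "l > 0"
      "(u * j) *\<^sub>R c + (v * k) *\<^sub>R e = l *\<^sub>R z"
      by (rule geodesic_arc_meets_cone)
    moreover from this have "z \<in> C"
      using assms * unfolding geodesically_convex_def by blast
    ultimately have "u *\<^sub>R a + v *\<^sub>R b = l *\<^sub>R z" "l > 0" "z \<in> C" using * by auto
    then show ?thesis by blast
  qed
  \<comment> \<open>Zero weights are treated apart, as the arc argument needs both weights
    positive.\<close>
  then have "u *\<^sub>R a + v *\<^sub>R b \<in> ?K" if "a \<in> ?K" "b \<in> ?K" "u \<ge> 0" "v \<ge> 0" "u + v = 1" for a b u v
    using that by (cases "u = 0"; cases "v = 0") simp_all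
  then show ?thesis unfolding convex_def by blast
qed

section \<open>Witnesses as solutions of the linear system\<close>

theorem mainTheorem4:
  fixes A \<sigma> :: "((real ^ 'n) \<times> real) set" and p :: nat
  assumes "A \<subseteq> hyperbolic_space"
    and "simplex_in A p \<sigma>"
  shows "((\<exists>x. strong_witness A \<sigma> x) \<longleftrightarrow>
            (\<forall>\<tau>. subsimplex \<tau> \<sigma> \<longrightarrow> (\<exists>x. weak_witness A \<tau> x))) \<and>
         (\<forall>x :: ((real ^ 'n) \<times> real) set \<Rightarrow> (real ^ 'n) \<times> real.
            (\<forall>I. subsimplex I \<sigma> \<longrightarrow> weak_witness A I (x I)) \<longrightarrow>
            (\<exists>z \<in> geodesically_convex hull {x I | I. subsimplex I \<sigma>}. strong_witness A \<sigma> z))"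
proof -
  have \<sigma>: "finite \<sigma>" "\<sigma> \<noteq> {}" "\<sigma> \<subseteq> A" using assms(2) by (auto simp: simplex_in_def)
  have part2: "\<exists>z \<in> geodesically_convex hull {x I | I. subsimplex I \<sigma>}. strong_witness A \<sigma> z"
    if weak: "\<And>I. subsimplex I \<sigma> \<Longrightarrow> weak_witness A I (x I)" for x :: "((real ^ 'n) \<times> real) set \<Rightarrow> _"
  proof -
    let ?X = "{x I | I. subsimplex I \<sigma>}"
    \<comment> \<open>Reflecting the space component turns \<open>- lorentz_form\<close> into the
      Euclidean inner product.\<close>
    define J :: "(real ^ 'n) \<times> real \<Rightarrow> (real ^ 'n) \<times> real" where "J c = (- fst c, snd c)" for c
    have J: "z \<bullet> J c = - lorentz_form z c" for z c
      by (simp add: J_def lorentz_form_def inner_prod_def)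
    have lin: "x I \<bullet> J a \<le> x I \<bullet> J b" if "I \<noteq> {}" "I \<subseteq> \<sigma>" "a \<in> I" "b \<in> A - I" for I a b
    proof -
      have "x I \<in> hyperbolic_space" "hyp_dist (x I) a \<le> hyp_dist (x I) b"
        using weak[of I] that by (auto simp: subsimplex_def weak_witness_def)
      moreover have "a \<in> hyperbolic_space" "b \<in> hyperbolic_space" using that \<sigma>(3) assms(1) by auto
      ultimately show ?thesis by (simp add: J hyp_dist_le_iff)
    qed
    have "\<exists>z \<in> convex hull ?X. \<forall>a\<in>\<sigma>. \<forall>b\<in>A. z \<bullet> J a \<le> z \<bullet> J b"
      unfolding subsimplex_def by (rule exists_convex_comb_minimizing_all[OF \<sigma>]) (rule lin)
    then obtain z where z: "z \<in> convex hull ?X" "\<And>a b. a \<in> \<sigma> \<Longrightarrow> b \<in> A \<Longrightarrow> z \<bullet> J a \<le> z \<bullet> J b"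
      by blast
    \<comment> \<open>Applied to all of hyperbolic space this yields the witness \<open>c\<close> on
      the ray of \<open>z\<close>; applied to any other \<open>C\<close> it shows that
      \<open>C\<close> meets this ray.\<close>
    have cone: "\<exists>k c. k > 0 \<and> c \<in> C \<and> z = k *\<^sub>R c" if C: "geodesically_convex C" "?X \<subseteq> C" for C
    proof -
      have "?X \<subseteq> {k *\<^sub>R c | k c. k > 0 \<and> c \<in> C}"
        using C(2) by (force intro: exI[of _ 1])
      from hull_minimal[of _ _ convex, OF this convex_cone_over_geodesically_convex[OF C(1)]] z(1)
      show ?thesis by blast
    qed
    have X_sub: "?X \<subseteq> hyperbolic_space" using weak by (auto simp: weak_witness_def)
    have "geodesically_convex (hyperbolic_space :: ((real ^ 'n) \<times> real) set)"
      by (auto simp: geodesically_convex_def geodesic_arc_def)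
    from cone[OF this X_sub] obtain k c where
      c: "k > 0" "c \<in> hyperbolic_space" "z = k *\<^sub>R c" by blast
    \<comment> \<open>The Lorentzian square of \<open>z\<close> determines the scaling factor, so
      the ray meets every such \<open>C\<close> in the same point \<open>c\<close>.\<close>
    have "c \<in> C" if C: "geodesically_convex C" "?X \<subseteq> C" for C
    proof -
      from cone[OF C] obtain j e where e: "j > 0" "e \<in> C" "z = j *\<^sub>R e" by blast
      have "e \<in> hyperbolic_space" using e(2) C(1) by (auto simp: geodesically_convex_def)
      then have "lorentz_form z z = - (j\<^sup>2)"
        using e(3) by (simp add: hyperbolic_space_def power2_eq_square)
      moreover have "lorentz_form z z = - (k\<^sup>2)"
        using c by (simp add: hyperbolic_space_def power2_eq_square)
      ultimately have "j = k" using e(1) c(1) by simp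
      then show ?thesis using e c by simp
    qed
    then have "c \<in> geodesically_convex hull ?X" by (simp add: hull_def)
    \<comment> \<open>Here \<open>b\<close> may also lie in \<open>\<sigma>\<close>, so antisymmetry
      gives equidistance.\<close>
    moreover have le: "hyp_dist c a \<le> hyp_dist c b" if "a \<in> \<sigma>" "b \<in> A" for a b
    proof -
      have "a \<in> hyperbolic_space" "b \<in> hyperbolic_space" using that \<sigma>(3) assms(1) by auto
      then show ?thesis using z(2)[OF that] c by (simp add: hyp_dist_le_iff J)
    qed
    have "strong_witness A \<sigma> c"
      unfolding strong_witness_def weak_witness_def
      by (intro conjI ballI antisym) (use le c(2) \<sigma>(3) in blast)+
    ultimately show ?thesis by blast
  qed
  \<comment> \<open>A point of \<open>A - \<tau>\<close> is either in \<open>\<sigma>\<close>, hence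
    equidistant, or outside it, hence no nearer.\<close>
  have "weak_witness A \<tau> x" if "strong_witness A \<sigma> x" "subsimplex \<tau> \<sigma>" for x \<tau>
    using that unfolding strong_witness_def weak_witness_def subsimplex_def
    by (metis Diff_iff order_refl subsetD)
  moreover have "\<exists>x. strong_witness A \<sigma> x" if "\<forall>\<tau>. subsimplex \<tau> \<sigma> \<longrightarrow> (\<exists>x. weak_witness A \<tau> x)"
    using that part2[of "\<lambda>I. SOME y. weak_witness A I y"] by (metis (mono_tags, lifting) someI_ex)
  ultimately show ?thesis using part2 by blast
qed

end
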